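(* Let $r\ge 1$, $k=\lfloor r/2\rfloor$, $l=\lfloor (r-1)/2\rfloor$, and let $h_r=g_k$ if $r=2k+1$ and $h_r=b_k$ if $r=2k$. Then for every integer $N\ge k+l$ (with $N\ge 1$), $$d_r(N)=\det\left(h_r(\gamma)(\gamma+2)^l|_N\right)=\det\left(\tfrac{1}{2}\left(h_r(\alpha_N)(\alpha_N+2)^l+h_r(\beta_N)(\beta_N+2)^l\right)\right),$$ where $d_r(N)=\det\left(\binom{2i+2j+r}{i+j}\right)_{i,j=0}^{N-1}$.
   Context: $\gamma$ is the infinite matrix indexed by $\mathbb{Z}_{\ge 0}$ with $(i,j)$ entry $1$ if $|i-j|=1$ or $i=j=0$, and $0$ otherwise; $\gamma_n=\gamma|_n$, where $M|_n$ denotes the leading principal $n\times n$ submatrix (rows/columns $0,\dots,n-1$). Polynomials in $\gamma$ are well-defined, and a constant $c$ in a matrix expression means $cI$. $J_N$ is the $N\times N$ exchange matrix, $Q_N=\begin{pmatrix}J_N & I_N\end{pmatrix}$, $\sigma_{2N}(\varepsilon)$ is the $2N\times2N$ matrix with $(i,j)$ entry $1$ if $i=j+1$, $\varepsilon$ if $(i,j)=(0,2N-1)$, $0$ otherwise; $\alpha_N=Q_N\sigma_{2N}(1)Q_N^\top$, $\beta_N=Q_N\sigma_{2N}(-1)Q_N^\top$ (equivalently $\gamma_N$ with its $(N-1,N-1)$ entry increased resp. decreased by $1$). $g_n(x)=\det(xI_n-\gamma_n)$ (with $g_0=1$) and $b_n(x)=\det(xI_n-\beta_n)$ for $n\ge1$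 are characteristic polynomials. Binomial coefficients with lower index negative or exceeding the upper are $0$. *)

theory Defs
  imports Jordan_Normal_Form.Char_Poly "HOL.Real"
begin

text \<open>
  Infinite matrices are functions of a row and a column index in the natural numbers. The product
  sums over the support of a row of the left factor, so it is the usual matrix product whenever the
  left factor is row-finite (every row has finite support). This is the case for the band matrix
  \<open>gamma\<close> below and hence for all polynomials in it.
\<close>

type_synonym inf_mat = "nat \<Rightarrow> nat \<Rightarrow> real"

definition inf_const :: "real \<Rightarrow> inf_mat" where
  "inf_const c = (\<lambda>i j. if i = j then c else 0)"

definition inf_add :: "inf_mat \<Rightarrow> inf_mat \<Rightarrow> inf_mat" where
  "inf_add A B = (\<lambda>i j. A i j + B i j)"

definition inf_mult :: "inf_mat \<Rightarrow> inf_mat \<Rightarrow> inf_mat" where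
  "inf_mult A B = (\<lambda>i j. \<Sum>m | A i m \<noteq> 0. A i m * B m j)"

fun inf_pow :: "inf_mat \<Rightarrow> nat \<Rightarrow> inf_mat" where
  "inf_pow A 0 = inf_const 1"
| "inf_pow A (Suc n) = inf_mult (inf_pow A n) A"

definition inf_poly :: "real poly \<Rightarrow> inf_mat \<Rightarrow> inf_mat" where
  "inf_poly p A = (\<lambda>i j. \<Sum>n\<le>degree p. coeff p n * inf_pow A n i j)"

definition leading :: "nat \<Rightarrow> inf_mat \<Rightarrow> real mat" where
  "leading n A = mat n n (\<lambda>(i, j). A i j)"

definition mat_poly :: "real poly \<Rightarrow> real mat \<Rightarrow> real mat" where
  "mat_poly p A = mat (dim_row A) (dim_row A)
     (\<lambda>(i, j). \<Sum>n\<le>degree p. coeff p n * (A ^\<^sub>m n) $$ (i, j))"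

definition gamma :: inf_mat where
  "gamma = (\<lambda>i j. if i = j + 1 \<or> j = i + 1 \<or> (i = 0 \<and> j = 0) then 1 else 0)"

definition J_mat :: "nat \<Rightarrow> real mat" where
  "J_mat N = mat N N (\<lambda>(i, j). if i + j + 1 = N then 1 else 0)"

definition Q_mat :: "nat \<Rightarrow> real mat" where
  "Q_mat N = four_block_mat (J_mat N) (1\<^sub>m N) (0\<^sub>m 0 N) (0\<^sub>m 0 N)"

text \<open>The argument \<open>N\<close> is half the size of \<open>sigma N e\<close>.\<close>

definition sigma :: "nat \<Rightarrow> real \<Rightarrow> real mat" where
  "sigma N e = mat (2 * N) (2 * N)
     (\<lambda>(i, j). if i = j + 1 then 1 else if i = 0 \<and> j = 2 * N - 1 then e else 0)"

definition alpha :: "nat \<Rightarrow> real mat" where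
  "alpha N = Q_mat N * sigma N 1 * transpose_mat (Q_mat N)"

definition beta :: "nat \<Rightarrow> real mat" where
  "beta N = Q_mat N * sigma N (- 1) * transpose_mat (Q_mat N)"

definition g_poly :: "nat \<Rightarrow> real poly" where
  "g_poly n = char_poly (leading n gamma)"

definition b_poly :: "nat \<Rightarrow> real poly" where
  "b_poly n = char_poly (beta n)"

definition h_poly :: "nat \<Rightarrow> real poly" where
  "h_poly r = (if odd r then g_poly (r div 2) else b_poly (r div 2))"

definition d_det :: "nat \<Rightarrow> nat \<Rightarrow> real" where
  "d_det r N = det (mat N N (\<lambda>(i, j). of_nat ((2 * i + 2 * j + r) choose (i + j))))"

end

theory Submission
  imports Defs
begin

text \<open>
  On sequences over the integers that are symmetric under \<open>i \<mapsto> - 1 - i\<close>, the matrix \<open>\<gamma>\<close> acts as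
  \<open>S a i = a (i - 1) + a (i + 1)\<close>; if the sequences are moreover \<open>2N\<close>-periodic (antiperiodic), then
  \<open>\<alpha>\<^sub>N\<close> (\<open>\<beta>\<^sub>N\<close>) acts as \<open>S\<close>, too. Hence, with \<open>F = h\<^sub>r \<sqdot> (X + 2)\<^sup>l\<close>, the \<open>j\<close>-th columns of \<open>F(\<gamma>)\<close>,
  \<open>F(\<alpha>\<^sub>N)\<close> and \<open>F(\<beta>\<^sub>N)\<close> are obtained by applying \<open>F(S)\<close> to the symmetric, symmetric periodic and symmetric
  antiperiodic extension of \<open>\<delta>\<^sub>j\<close>. The mean of the last two extensions agrees with the first one near the origin,
  and \<open>F(S)\<close> only sees distances up to \<open>deg F \<le> N\<close>, so that \<open>F(\<gamma>)|\<^sub>N\<close> \<^emph>\<open>equals\<close> the mean of \<open>F(\<alpha>\<^sub>N)\<close> and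
  \<open>F(\<beta>\<^sub>N)\<close>.

  For the Hankel matrix, \<open>g\<^sub>k(S)\<close> maps the symmetric extension of \<open>\<delta>\<^sub>0\<close> to that of \<open>\<delta>\<^sub>k\<close>,
  \<open>b\<^sub>k = g\<^sub>k + g\<^sub>k\<^sub>-\<^sub>1\<close>, and the entries of \<open>(S + 2)\<^sup>m\<close> are the binomial coefficients of order \<open>2m\<close>. This gives
  \<open>(F(\<gamma>) (\<gamma> + 2)\<^sup>n)\<^sub>0\<^sub>0 = binom (2n + r) n\<close>. Since the \<open>(\<gamma> + 2)\<^sup>j \<delta>\<^sub>0\<close> with \<open>j < N\<close> are the columns of a unitriangular
  matrix \<open>U\<close>, the Hankel matrix is \<open>U\<^sup>T F(\<gamma>)|\<^sub>N U\<close>.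
\<close>

section \<open>Polynomials acting on bi-infinite sequences\<close>

definition shift_sum :: "(int \<Rightarrow> real) \<Rightarrow> int \<Rightarrow> real" where
  "shift_sum a = (\<lambda>i. a (i - 1) + a (i + 1))"

text \<open>This is p(S) for S = \<open>shift_sum\<close>. The sum runs over the same range as in
  \<open>inf_poly\<close> and \<open>mat_poly\<close>, so that the three can be compared coefficient
  by coefficient.\<close>

definition poly_act :: "real poly \<Rightarrow> (int \<Rightarrow> real) \<Rightarrow> int \<Rightarrow> real" where
  "poly_act p a = (\<lambda>i. \<Sum>n\<le>degree p. coeff p n * (shift_sum ^^ n) a i)"

lemma poly_act_0 [simp]: "poly_act 0 a = (\<lambda>i. 0)"
  by (simp add: poly_act_def)

lemma poly_act_1 [simp]: "poly_act 1 a = a"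
  by (simp add: poly_act_def)

lemma poly_act_bound:
  assumes "degree p \<le> K"
  shows "poly_act p a i = (\<Sum>n\<le>K. coeff p n * (shift_sum ^^ n) a i)"
  unfolding poly_act_def
  by (rule sum.mono_neutral_left) (use assms in \<open>auto simp: coeff_eq_0\<close>)

lemma shift_sum_sum:
  "shift_sum (\<lambda>i. \<Sum>m\<in>A. c m * f m i) = (\<lambda>i. \<Sum>m\<in>A. c m * shift_sum (f m) i)"
  by (simp add: shift_sum_def sum.distrib algebra_simps fun_eq_iff)

lemma poly_act_pCons: "poly_act (pCons c p) a = (\<lambda>i. c * a i + shift_sum (poly_act p a) i)"
proof
  fix i
  have "degree (pCons c p) \<le> Suc (degree p)" by (simp add: degree_pCons_le)
  then have "poly_act (pCons c p) a i =
      (\<Sum>n\<le>Suc (degree p). coeff (pCons c p) n * (shift_sum ^^ n) a i)"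
    by (rule poly_act_bound)
  also have "\<dots> = c * a i + (\<Sum>n\<le>degree p. coeff p n * shift_sum ((shift_sum ^^ n) a) i)"
    by (subst sum.atMost_Suc_shift) simp
  also have "\<dots> = c * a i + shift_sum (poly_act p a) i"
    by (simp add: poly_act_def shift_sum_sum)
  finally show "poly_act (pCons c p) a i = c * a i + shift_sum (poly_act p a) i" .
qed

lemma poly_act_X: "poly_act [:0, 1:] a = shift_sum a"
  by (simp add: poly_act_pCons shift_sum_def)

lemma poly_act_add: "poly_act (p + q) a = (\<lambda>i. poly_act p a i + poly_act q a i)"
proof
  fix i
  let ?K = "max (degree p) (degree q)"
  show "poly_act (p + q) a i = poly_act p a i + poly_act q a i"
    using poly_act_bound[of "p + q" ?K a i] poly_act_bound[of p ?K a i]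
      poly_act_bound[of q ?K a i] degree_add_le_max[of p q]
    by (simp add: sum.distrib algebra_simps)
qed

lemma poly_act_smult: "poly_act (Polynomial.smult c p) a = (\<lambda>i. c * poly_act p a i)"
  by (rule ext, subst poly_act_bound[of _ "degree p"])
    (auto simp: poly_act_def sum_distrib_left algebra_simps)

lemma poly_act_mult: "poly_act (p * q) a = poly_act p (poly_act q a)"
  by (induction p) (simp_all add: poly_act_add poly_act_smult poly_act_pCons)

lemma poly_act_sum_right:
  "poly_act p (\<lambda>i. \<Sum>m\<in>A. c m * f m i) = (\<lambda>i. \<Sum>m\<in>A. c m * poly_act p (f m) i)"
proof (induction p)
  case (pCons d p)
  then show ?case
    by (simp add: poly_act_pCons shift_sum_sum sum.distrib sum_distrib_left algebra_simps)
qed simp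

lemma poly_act_lincomb:
  "poly_act p (\<lambda>i. c * a i + d * b i) = (\<lambda>i. c * poly_act p a i + d * poly_act p b i)"
proof (induction p)
  case (pCons e p)
  then show ?case
    by (simp add: poly_act_pCons shift_sum_def algebra_simps)
qed simp

lemma poly_act_add_right: "poly_act p (\<lambda>i. a i + b i) = (\<lambda>i. poly_act p a i + poly_act p b i)"
  using poly_act_lincomb[of p 1 a 1 b] by simp

text \<open>Each application of S looks one step further to either side, so p(S) at \<open>i\<close>
  depends only on the values within distance \<open>degree p\<close>.\<close>

lemma poly_act_cong:
  assumes "degree p \<le> d"
    and "\<And>m. \<bar>m - i\<bar> \<le> int d \<Longrightarrow> a m = b m"
  shows "poly_act p a i = poly_act p b i"
  using assms
proof (induction p arbitrary: d i)
  case (pCons c p)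
  have "poly_act p a j = poly_act p b j" if "j = i - 1 \<or> j = i + 1" for j
  proof (cases "p = 0")
    case False
    then have d: "Suc (degree p) \<le> d" using pCons.prems(1) by simp
    show ?thesis
      by (rule pCons.IH[of "d - 1"]) (use d that in \<open>auto intro!: pCons.prems(2)\<close>)
  qed simp
  then show ?case
    using pCons.prems(2)[of i] by (simp add: poly_act_pCons shift_sum_def)
qed simp

section \<open>Symmetric and quasi-periodic sequences\<close>

definition reflective :: "(int \<Rightarrow> real) set" where
  "reflective = {a. \<forall>i. a (- 1 - i) = a i}"

definition quasi_periodic :: "nat \<Rightarrow> real \<Rightarrow> (int \<Rightarrow> real) set" where
  "quasi_periodic N e = {a. \<forall>i. a (i + int N) = e * a i}"

lemma reflectiveD: "a \<in> reflective \<Longrightarrow> a (- 1 - i) = a i"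
  by (simp add: reflective_def)

lemma quasi_periodicD: "a \<in> quasi_periodic N e \<Longrightarrow> a (i + int N) = e * a i"
  by (simp add: quasi_periodic_def)

lemma shift_sum_reflective:
  assumes "a \<in> reflective"
  shows "shift_sum a \<in> reflective"
  unfolding reflective_def
proof (clarify)
  fix i
  have "a (- 1 - i - 1) = a (i + 1)" "a (- 1 - i + 1) = a (i - 1)"
    using reflectiveD[OF assms, of "i + 1"] reflectiveD[OF assms, of "i - 1"]
    by (simp_all add: algebra_simps)
  then show "shift_sum a (- 1 - i) = shift_sum a i"
    by (simp add: shift_sum_def)
qed

lemma shift_sum_quasi_periodic:
  assumes "a \<in> quasi_periodic N e"
  shows "shift_sum a \<in> quasi_periodic N e"
  unfolding quasi_periodic_def
proof (clarify)
  fix i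
  show "shift_sum a (i + int N) = e * shift_sum a i"
    using quasi_periodicD[OF assms, of "i + 1"] quasi_periodicD[OF assms, of "i - 1"]
    by (simp add: shift_sum_def algebra_simps)
qed

lemma poly_act_reflective: "a \<in> reflective \<Longrightarrow> poly_act p a \<in> reflective"
proof (induction p)
  case (pCons c p)
  then show ?case
    using shift_sum_reflective[of "poly_act p a"] by (simp add: poly_act_pCons reflective_def)
qed (simp add: reflective_def)

lemma poly_act_quasi_periodic: "a \<in> quasi_periodic N e \<Longrightarrow> poly_act p a \<in> quasi_periodic N e"
proof (induction p)
  case (pCons c p)
  then show ?case
    using shift_sum_quasi_periodic[of "poly_act p a"]
    by (simp add: poly_act_pCons quasi_periodic_def algebra_simps)
qed (simp add: quasi_periodic_def)

definition unit_seq :: "int \<Rightarrow> int \<Rightarrow> real" where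
  "unit_seq a = (\<lambda>i. if i = a then 1 else 0)"

text \<open>Since \<open>a\<close> and \<open>- 1 - a\<close> never coincide, this takes only the
  values 0 and 1. Allowing negative \<open>a\<close> spares \<open>shift_sum_refl_unit\<close> a
  boundary case: \<open>refl_unit (- 1)\<close> is \<open>refl_unit 0\<close>.\<close>

definition refl_unit :: "int \<Rightarrow> int \<Rightarrow> real" where
  "refl_unit a = (\<lambda>i. unit_seq a i + unit_seq (- 1 - a) i)"

lemma refl_unit_reflective: "refl_unit a \<in> reflective"
  by (auto simp: refl_unit_def unit_seq_def reflective_def)

lemma shift_sum_refl_unit: "shift_sum (refl_unit a) = (\<lambda>i. refl_unit (a - 1) i + refl_unit (a + 1) i)"
  by (rule ext) (auto simp: shift_sum_def refl_unit_def unit_seq_def)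

lemma shift_sum_poly_act: "shift_sum (poly_act p a) = poly_act p (shift_sum a)"
  by (simp add: poly_act_X[symmetric] poly_act_mult[symmetric] del: mult_pCons_left mult_pCons_right)
    (simp add: mult.commute)

text \<open>The symmetry of the matrix p(\<open>gamma\<close>). S acts on the position of the unit
  in the same way as on the argument of the sequence, so it can be moved from one to the
  other.\<close>

lemma poly_act_refl_unit_swap: "poly_act p (refl_unit a) b = poly_act p (refl_unit b) a"
proof (induction p arbitrary: a b)
  case (pCons c p)
  have "shift_sum (poly_act p (refl_unit a)) b = shift_sum (poly_act p (refl_unit b)) a"
    unfolding shift_sum_poly_act[of p "refl_unit b"] shift_sum_refl_unit poly_act_add_right
    unfolding shift_sum_def by (simp add: pCons.IH[of a])
  moreover have "refl_unit a b = refl_unit b a"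
    by (auto simp: refl_unit_def unit_seq_def)
  ultimately show ?case
    by (simp add: poly_act_pCons)
qed simp

lemma refl_unit_expansion:
  assumes "a \<in> reflective" "- int N \<le> i" "i < int N"
  shows "(\<Sum>m<N. a (int m) * refl_unit (int m) i) = a i"
proof -
  \<comment> \<open>The representative of \<open>i\<close> modulo the reflection that lies in the
    natural numbers.\<close>
  define m0 where "m0 = (if i \<ge> 0 then nat i else nat (- 1 - i))"
  have m0: "m0 < N" "a (int m0) = a i"
    using assms reflectiveD[OF assms(1), of i] by (auto simp: m0_def)
  have "(\<Sum>m<N. a (int m) * refl_unit (int m) i) = (\<Sum>m<N. if m = m0 then a (int m) else 0)"
    by (rule sum.cong) (auto simp: m0_def refl_unit_def unit_seq_def)
  then show ?thesis
    using m0 by simp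
qed

section \<open>The entries of the powers of \<open>\<gamma> + 2\<close>\<close>

text \<open>The coefficient of x^j in (x + 2 + 1/x)^m = (1 + x)^(2m) / x^m. The case distinction
  keeps \<open>nat\<close> from turning a negative lower index into 0.\<close>

definition central_binomial :: "nat \<Rightarrow> int \<Rightarrow> real" where
  "central_binomial m j = (if j + int m < 0 then 0 else of_nat ((2 * m) choose nat (j + int m)))"

text \<open>Pascal's rule applied twice. The lower indices -1 and 0 are treated apart because some
  of the neighbouring binomials then vanish by convention.\<close>

lemma central_binomial_Suc:
  "central_binomial (Suc m) j =
     central_binomial m (j - 1) + 2 * central_binomial m j + central_binomial m (j + 1)"
proof -
  have "j + int m = int (nat (j + int m - 1)) + 1" if "j + int m \<ge> 1"
    using that by simp
  then consider "j + int m < - 1" | "j + int m = - 1" | "j + int m = 0" | t where "j + int m = int t + 1"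
    by fastforce
  then show ?thesis
  proof cases
    case 4
    have "nat (j + int (Suc m)) = Suc (Suc t)" "nat (j - 1 + int m) = t" "nat (j + int m) = Suc t"
      "nat (j + 1 + int m) = Suc (Suc t)"
      using 4 by auto
    then show ?thesis
      using 4 by (simp add: central_binomial_def)
  next
    case 3
    then have "nat (j + int (Suc m)) = 1" "nat (j + 1 + int m) = 1" by auto
    then show ?thesis
      using 3 by (simp add: central_binomial_def)
  qed (auto simp: central_binomial_def)
qed

lemma poly_act_power_unit: "poly_act ([:2, 1:] ^ m) (unit_seq a) i = central_binomial m (i - a)"
proof (induction m arbitrary: i)
  case (Suc m)
  have "poly_act ([:2, 1:] ^ Suc m) (unit_seq a) i =
      poly_act [:2, 1:] (poly_act ([:2, 1:] ^ m) (unit_seq a)) i"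
    by (simp only: power_Suc poly_act_mult)
  also have "\<dots> = central_binomial (Suc m) (i - a)"
    by (simp add: poly_act_pCons shift_sum_def Suc central_binomial_Suc algebra_simps)
  finally show ?case .
qed (auto simp: unit_seq_def central_binomial_def)

lemma poly_act_power_refl_unit:
  "poly_act ([:2, 1:] ^ m) (refl_unit a) i = central_binomial m (i - a) + central_binomial m (i + a + 1)"
  unfolding refl_unit_def by (simp add: poly_act_add_right poly_act_power_unit algebra_simps)

text \<open>Pascal's rule for binom(2n + 2k + 1, n). The term with lower index n - 1 is written with
  the complementary index 2k + n + 1, which is also correct for n = 0.\<close>

lemma moment_odd: "central_binomial (k + n) (- int k) + central_binomial (k + n) (int k + 1)
    = of_nat ((2 * n + (2 * k + 1)) choose n)"
proof -
  have e: "nat (- int k + int (k + n)) = n" "nat (int k + 1 + int (k + n)) = Suc (2 * k + n)" by auto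
  have "(2 * n + (2 * k + 1)) choose n = Suc (2 * (k + n)) choose Suc (2 * k + n)"
    using binomial_symmetric[of n "2 * n + (2 * k + 1)"] by (simp add: algebra_simps)
  also have "\<dots> = ((2 * (k + n)) choose n) + ((2 * (k + n)) choose Suc (2 * k + n))"
    using binomial_symmetric[of n "2 * (k + n)"] by (simp add: algebra_simps)
  finally show ?thesis
    using e by (simp add: central_binomial_def)
qed

text \<open>One more application of Pascal's rule: one part is the odd moment, and the other splits
  into the two remaining binomials.\<close>

lemma moment_even:
  "central_binomial (k + n) (- int (Suc k)) + central_binomial (k + n) (int (Suc k) + 1)
     + (central_binomial (k + n) (- int k) + central_binomial (k + n) (int k + 1))
    = of_nat ((2 * n + 2 * Suc k) choose n)"
proof -
  have "(2 * n + 2 * Suc k) choose n = Suc (Suc (2 * (k + n))) choose Suc (Suc (2 * k + n))"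
    using binomial_symmetric[of n "2 * n + 2 * Suc k"] by (simp add: algebra_simps)
  also have "\<dots> = ((2 * n + (2 * k + 1)) choose n)
      + ((2 * (k + n)) choose Suc (2 * k + n)) + ((2 * (k + n)) choose Suc (Suc (2 * k + n)))"
    using binomial_symmetric[of n "2 * n + (2 * k + 1)"] by (simp add: algebra_simps)
  finally have A: "of_nat ((2 * n + 2 * Suc k) choose n) = (of_nat ((2 * n + (2 * k + 1)) choose n)
      + of_nat ((2 * (k + n)) choose Suc (2 * k + n))
      + of_nat ((2 * (k + n)) choose Suc (Suc (2 * k + n))) :: real)"
    by simp
  have B: "central_binomial (k + n) (int (Suc k) + 1) = of_nat ((2 * (k + n)) choose Suc (Suc (2 * k + n)))"
  proof -
    have "nat (int (Suc k) + 1 + int (k + n)) = Suc (Suc (2 * k + n))" by simp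
    then show ?thesis by (simp only: central_binomial_def) simp
  qed
  have C: "central_binomial (k + n) (- int (Suc k)) = of_nat ((2 * (k + n)) choose Suc (2 * k + n))"
  \<comment> \<open>For n = 0 the lower index on the left is -1 and the one on the right exceeds the
    upper index, so both sides are 0.\<close>
  proof (cases n)
    case (Suc n')
    have "nat (- int (Suc k) + int (k + n)) = n'" using Suc by simp
    moreover have "(2 * (k + n)) choose n' = (2 * (k + n)) choose Suc (2 * k + n)"
      using binomial_symmetric[of n' "2 * (k + n)"] Suc by (simp add: algebra_simps)
    ultimately show ?thesis using Suc by (simp add: central_binomial_def)
  qed (simp add: central_binomial_def)
  show ?thesis
    unfolding moment_odd B C A by simp
qed

section \<open>Characteristic polynomials of the tridiagonal matrices\<close>

text \<open>Laplace expansion along the last row, then along the last column of the remaining minor.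
  Using one entry function \<open>f\<close> for all sizes makes the minors leading blocks of the
  same matrix.\<close>

lemma det_tridiagonal_corner:
  fixes f :: "nat \<Rightarrow> nat \<Rightarrow> 'a::comm_ring_1"
  assumes row: "\<And>j. j < n \<Longrightarrow> f (Suc n) j = 0"
    and col: "\<And>i. i < n \<Longrightarrow> f i (Suc n) = 0"
  shows "det (mat (Suc (Suc n)) (Suc (Suc n)) (\<lambda>(i, j). f i j)) =
    f (Suc n) (Suc n) * det (mat (Suc n) (Suc n) (\<lambda>(i, j). f i j))
    - f n (Suc n) * f (Suc n) n * det (mat n n (\<lambda>(i, j). f i j))"
proof -
  let ?A = "mat (Suc (Suc n)) (Suc (Suc n)) (\<lambda>(i, j). f i j)"
  let ?B = "mat_delete ?A (Suc n) n"
  have B: "?B \<in> carrier_mat (Suc n) (Suc n)"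
    unfolding carrier_mat_def mat_delete_def by simp
  have D1: "mat_delete ?A (Suc n) (Suc n) = mat (Suc n) (Suc n) (\<lambda>(i, j). f i j)"
    by (rule eq_matI) (auto simp: mat_delete_def)
  have D2: "mat_delete ?B n n = mat n n (\<lambda>(i, j). f i j)"
    by (rule eq_matI) (auto simp: mat_delete_def)
  have Bcol: "?B $$ (i, n) = f i (Suc n)" if "i < Suc n" for i
    using that by (auto simp: mat_delete_def)
  \<comment> \<open>The last column of \<open>?B\<close> is the last column of \<open>?A\<close>
    without its bottom entry, so only row \<open>n\<close> contributes.\<close>
  have "det ?B = (\<Sum>i<Suc n. ?B $$ (i, n) * cofactor ?B i n)"
    by (rule laplace_expansion_column[OF B]) simp
  also have "\<dots> = f n (Suc n) * cofactor ?B n n"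
    using col by (simp add: Bcol del: mat_delete_dim)
  also have "\<dots> = f n (Suc n) * det (mat n n (\<lambda>(i, j). f i j))"
    by (simp add: cofactor_def D2 mult_2[symmetric])
  finally have dB: "det ?B = f n (Suc n) * det (mat n n (\<lambda>(i, j). f i j))" .
  have "det ?A = (\<Sum>j<Suc (Suc n). ?A $$ (Suc n, j) * cofactor ?A (Suc n) j)"
    by (rule laplace_expansion_row) auto
  also have "\<dots> = f (Suc n) n * cofactor ?A (Suc n) n
      + f (Suc n) (Suc n) * cofactor ?A (Suc n) (Suc n)"
    using row by simp
  also have "cofactor ?A (Suc n) (Suc n) = det (mat (Suc n) (Suc n) (\<lambda>(i, j). f i j))"
    by (simp add: cofactor_def D1 mult_2[symmetric])
  also have "cofactor ?A (Suc n) n = - (f n (Suc n) * det (mat n n (\<lambda>(i, j). f i j)))"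
    by (simp add: cofactor_def dB mult_2[symmetric])
  finally show ?thesis
    by (simp add: algebra_simps)
qed

lemma char_poly_mat:
  fixes f :: "nat \<Rightarrow> nat \<Rightarrow> 'a::comm_ring_1"
  shows "char_poly (mat n n (\<lambda>(i, j). f i j))
    = det (mat n n (\<lambda>(i, j). if i = j then [:- f i j, 1:] else [:- f i j:]))"
  unfolding char_poly_def char_poly_matrix_def
  by (rule arg_cong[of _ _ det], rule eq_matI) auto

lemma g_poly_0: "g_poly 0 = 1"
  by (simp add: g_poly_def leading_def char_poly_mat det_def)

lemma g_poly_1: "g_poly (Suc 0) = [:- 1, 1:]"
  by (simp add: g_poly_def leading_def char_poly_mat det_single gamma_def)

text \<open>The exceptional diagonal 1 of \<open>gamma\<close> sits at index 0, so the last diagonal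
  entry here is just X.\<close>

lemma g_poly_Suc_Suc: "g_poly (Suc (Suc n)) = [:0, 1:] * g_poly (Suc n) - g_poly n"
  unfolding g_poly_def leading_def char_poly_mat
  by (subst det_tridiagonal_corner) (auto simp: gamma_def one_pCons)

text \<open>The reflected units satisfy the recurrence of \<open>g_poly\<close> with S in place of
  X. At n = 1, subtracting 1 removes the neighbour \<open>refl_unit (- 1)\<close>, which is
  \<open>refl_unit 0\<close>.\<close>

lemma poly_act_g_poly: "poly_act (g_poly n) (refl_unit 0) = refl_unit (int n)"
proof (induction n rule: induct_nat_012)
  case 1
  show ?case
    by (rule ext) (auto simp: g_poly_1 poly_act_pCons shift_sum_def refl_unit_def unit_seq_def)
next
  case (ge2 n)
  have "g_poly (Suc (Suc n)) = [:0, 1:] * g_poly (Suc n) + Polynomial.smult (- 1) (g_poly n)"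
    by (simp add: g_poly_Suc_Suc)
  then show ?case
    by (simp only: poly_act_add poly_act_mult poly_act_smult poly_act_X ge2 shift_sum_refl_unit)
      (simp add: algebra_simps)
qed (simp add: g_poly_0)



section \<open>Matrices acting on reflection-symmetric sequences\<close>

text \<open>On symmetric sequences, restricted to the natural numbers, the matrix acts as p(S).
  Row-finiteness is built in so that the property passes to products.\<close>

definition inf_acts :: "real poly \<Rightarrow> inf_mat \<Rightarrow> bool" where
  "inf_acts p A \<longleftrightarrow> (\<forall>i. finite {m. A i m \<noteq> 0}) \<and>
    (\<forall>a\<in>reflective. \<forall>i. (\<Sum>m | A i m \<noteq> 0. A i m * a (int m)) = poly_act p a (int i))"

lemma inf_actsI:
  assumes "\<And>i. finite (T i)" "\<And>i m. A i m \<noteq> 0 \<Longrightarrow> m \<in> T i"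
    and "\<And>a i. a \<in> reflective \<Longrightarrow> (\<Sum>m\<in>T i. A i m * a (int m)) = poly_act p a (int i)"
  shows "inf_acts p A"
  unfolding inf_acts_def
proof (intro conjI ballI allI)
  show "finite {m. A i m \<noteq> 0}" for i
    by (rule finite_subset[OF _ assms(1)[of i]]) (use assms(2) in auto)
  fix a :: "int \<Rightarrow> real" and i assume a: "a \<in> reflective"
  have "(\<Sum>m | A i m \<noteq> 0. A i m * a (int m)) = (\<Sum>m\<in>T i. A i m * a (int m))"
    by (rule sum.mono_neutral_left) (use assms in auto)
  then show "(\<Sum>m | A i m \<noteq> 0. A i m * a (int m)) = poly_act p a (int i)"
    using assms(3)[OF a] by simp
qed

lemma inf_acts_finite: "inf_acts p A \<Longrightarrow> finite {m. A i m \<noteq> 0}"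
  by (simp add: inf_acts_def)

lemma inf_acts_apply:
  assumes "inf_acts p A" "a \<in> reflective" "finite T" "\<And>m. A i m \<noteq> 0 \<Longrightarrow> m \<in> T"
  shows "(\<Sum>m\<in>T. A i m * a (int m)) = poly_act p a (int i)"
proof -
  have "(\<Sum>m | A i m \<noteq> 0. A i m * a (int m)) = (\<Sum>m\<in>T. A i m * a (int m))"
    by (rule sum.mono_neutral_left) (use assms in auto)
  then show ?thesis
    using assms by (simp add: inf_acts_def)
qed

text \<open>The only natural number in the support of \<open>refl_unit (int j)\<close> is
  \<open>j\<close>, so applying \<open>A\<close> to it reads off column \<open>j\<close>.\<close>

lemma inf_acts_entry:
  assumes "inf_acts p A"
  shows "A i j = poly_act p (refl_unit (int j)) (int i)"
proof -
  let ?T = "insert j {m. A i m \<noteq> 0}"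
  have "poly_act p (refl_unit (int j)) (int i) = (\<Sum>m\<in>?T. A i m * refl_unit (int j) (int m))"
    by (rule inf_acts_apply[symmetric])
      (use assms inf_acts_finite[OF assms] refl_unit_reflective in auto)
  also have "\<dots> = (\<Sum>m\<in>?T. if m = j then A i m else 0)"
    by (rule sum.cong) (auto simp: refl_unit_def unit_seq_def)
  also have "\<dots> = A i j"
    using inf_acts_finite[OF assms, of i] by (subst sum.delta) auto
  finally show ?thesis by simp
qed

lemma inf_acts_const: "inf_acts [:c:] (inf_const c)"
  by (rule inf_actsI[of "\<lambda>i. {i}"]) (auto simp: inf_const_def poly_act_pCons shift_sum_def split: if_splits)

lemma inf_acts_add:
  assumes "inf_acts p A" "inf_acts q B"
  shows "inf_acts (p + q) (inf_add A B)"
proof (rule inf_actsI[of "\<lambda>i. {m. A i m \<noteq> 0} \<union> {m. B i m \<noteq> 0}"])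
  fix a :: "int \<Rightarrow> real" and i assume a: "a \<in> reflective"
  let ?T = "{m. A i m \<noteq> 0} \<union> {m. B i m \<noteq> 0}"
  have T: "finite ?T" using assms by (simp add: inf_acts_finite)
  have "(\<Sum>m\<in>?T. A i m * a (int m)) = poly_act p a (int i)"
    by (rule inf_acts_apply[OF assms(1) a T]) auto
  moreover have "(\<Sum>m\<in>?T. B i m * a (int m)) = poly_act q a (int i)"
    by (rule inf_acts_apply[OF assms(2) a T]) auto
  ultimately show "(\<Sum>m\<in>?T. inf_add A B i m * a (int m)) = poly_act (p + q) a (int i)"
    by (simp add: inf_add_def poly_act_add algebra_simps sum.distrib)
qed (use assms in \<open>auto simp: inf_acts_finite inf_add_def\<close>)

lemma inf_acts_mult:
  assumes "inf_acts p A" "inf_acts q B"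
  shows "inf_acts (p * q) (inf_mult A B)"
proof (rule inf_actsI[of "\<lambda>i. \<Union>m\<in>{m. A i m \<noteq> 0}. {j. B m j \<noteq> 0}"])
  show "finite (\<Union>m\<in>{m. A i m \<noteq> 0}. {j. B m j \<noteq> 0})" for i
    using assms by (simp add: inf_acts_finite)
  show "j \<in> (\<Union>m\<in>{m. A i m \<noteq> 0}. {j. B m j \<noteq> 0})" if "inf_mult A B i j \<noteq> 0" for i j
    using that unfolding inf_mult_def by (auto elim!: sum.not_neutral_contains_not_neutral)
  fix a :: "int \<Rightarrow> real" and i assume a: "a \<in> reflective"
  let ?S = "{m. A i m \<noteq> 0}"
  let ?T = "\<Union>m\<in>?S. {j. B m j \<noteq> 0}"
  have T: "finite ?T" using assms by (simp add: inf_acts_finite)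
  have "(\<Sum>j\<in>?T. inf_mult A B i j * a (int j)) = (\<Sum>m\<in>?S. A i m * (\<Sum>j\<in>?T. B m j * a (int j)))"
    unfolding inf_mult_def sum_distrib_right sum_distrib_left
    by (subst sum.swap) (simp add: mult.assoc)
  also have "\<dots> = (\<Sum>m\<in>?S. A i m * poly_act q a (int m))"
  proof (rule sum.cong)
    fix m assume "m \<in> ?S"
    then have "(\<Sum>j\<in>?T. B m j * a (int j)) = poly_act q a (int m)"
      by (intro inf_acts_apply[OF assms(2) a T]) auto
    then show "A i m * (\<Sum>j\<in>?T. B m j * a (int j)) = A i m * poly_act q a (int m)" by simp
  qed simp
  also have "\<dots> = poly_act (p * q) a (int i)"
    unfolding poly_act_mult
    by (rule inf_acts_apply[OF assms(1)]) (use a assms in \<open>auto simp: poly_act_reflective inf_acts_finite\<close>)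
  finally show "(\<Sum>j\<in>?T. inf_mult A B i j * a (int j)) = poly_act (p * q) a (int i)" .
qed

lemma inf_acts_pow: "inf_acts p A \<Longrightarrow> inf_acts (p ^ n) (inf_pow A n)"
proof (induction n)
  case (Suc n)
  then show ?case
    using inf_acts_mult[of "p ^ n" "inf_pow A n" p A] by (simp add: mult.commute)
qed (use inf_acts_const[of 1] in \<open>simp add: one_pCons\<close>)

lemma poly_act_X_power: "poly_act ([:0, 1:] ^ n) a = (shift_sum ^^ n) a"
proof (induction n)
  case (Suc n)
  have "poly_act ([:0, 1:] ^ Suc n) a = poly_act [:0, 1:] (poly_act ([:0, 1:] ^ n) a)"
    by (simp only: power_Suc poly_act_mult)
  then show ?case
    by (simp only: Suc poly_act_X) simp
qed simp

lemma inf_acts_poly: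
  assumes "inf_acts [:0, 1:] A"
  shows "inf_acts p (inf_poly p A)"
proof (rule inf_actsI[of "\<lambda>i. \<Union>n\<in>{..degree p}. {j. inf_pow A n i j \<noteq> 0}"])
  note pow = inf_acts_pow[OF assms]
  show "finite (\<Union>n\<in>{..degree p}. {j. inf_pow A n i j \<noteq> 0})" for i
    using inf_acts_finite[OF pow] by simp
  show "j \<in> (\<Union>n\<in>{..degree p}. {j. inf_pow A n i j \<noteq> 0})" if "inf_poly p A i j \<noteq> 0" for i j
    using that unfolding inf_poly_def by (auto elim!: sum.not_neutral_contains_not_neutral)
  fix a :: "int \<Rightarrow> real" and i assume a: "a \<in> reflective"
  let ?T = "\<Union>n\<in>{..degree p}. {j. inf_pow A n i j \<noteq> 0}"
  have T: "finite ?T" using inf_acts_finite[OF pow] by simp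
  have "(\<Sum>j\<in>?T. inf_poly p A i j * a (int j)) =
      (\<Sum>n\<le>degree p. coeff p n * (\<Sum>j\<in>?T. inf_pow A n i j * a (int j)))"
    unfolding inf_poly_def sum_distrib_right sum_distrib_left
    by (subst sum.swap) (simp add: mult.assoc)
  also have "\<dots> = (\<Sum>n\<le>degree p. coeff p n * (shift_sum ^^ n) a (int i))"
  proof (rule sum.cong)
    fix n assume "n \<in> {..degree p}"
    then have "(\<Sum>j\<in>?T. inf_pow A n i j * a (int j)) = poly_act ([:0, 1:] ^ n) a (int i)"
      by (intro inf_acts_apply[OF pow a T]) auto
    then show "coeff p n * (\<Sum>j\<in>?T. inf_pow A n i j * a (int j))
        = coeff p n * (shift_sum ^^ n) a (int i)"
      by (simp only: poly_act_X_power)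
  qed simp
  finally show "(\<Sum>j\<in>?T. inf_poly p A i j * a (int j)) = poly_act p a (int i)"
    by (simp only: poly_act_def)
qed

lemma inf_acts_gamma: "inf_acts [:0, 1:] gamma"
proof (rule inf_actsI[of "\<lambda>i. {if i = 0 then 0 else i - 1, i + 1}"])
  fix a :: "int \<Rightarrow> real" and i assume a: "a \<in> reflective"
  show "(\<Sum>m\<in>{if i = 0 then 0 else i - 1, i + 1}. gamma i m * a (int m)) = poly_act [:0, 1:] a (int i)"
    \<comment> \<open>In row 0 the left neighbour has index -1, and a(-1) = a(0) produces the
      diagonal entry 1.\<close>
    using reflectiveD[OF a, of 0]
    by (cases i) (auto simp: gamma_def poly_act_X shift_sum_def add.commute)
qed (auto simp: gamma_def split: if_splits)

section \<open>Finite matrices acting on symmetric quasi-periodic sequences\<close>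

definition seq_vec :: "nat \<Rightarrow> (int \<Rightarrow> real) \<Rightarrow> real vec" where
  "seq_vec N a = vec N (\<lambda>i. a (int i))"

definition mat_acts :: "nat \<Rightarrow> real \<Rightarrow> real poly \<Rightarrow> real mat \<Rightarrow> bool" where
  "mat_acts N e p A \<longleftrightarrow> A \<in> carrier_mat N N \<and>
    (\<forall>a\<in>reflective \<inter> quasi_periodic (2 * N) e. A *\<^sub>v seq_vec N a = seq_vec N (poly_act p a))"

lemma seq_vec_carrier [simp]: "seq_vec N a \<in> carrier_vec N"
  by (simp add: seq_vec_def)

lemma mat_acts_carrier: "mat_acts N e p A \<Longrightarrow> A \<in> carrier_mat N N"
  by (simp add: mat_acts_def)

lemma mat_acts_apply:
  assumes "mat_acts N e p A" "a \<in> reflective" "a \<in> quasi_periodic (2 * N) e"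
  shows "A *\<^sub>v seq_vec N a = seq_vec N (poly_act p a)"
  using assms by (simp add: mat_acts_def)

lemma index_mat_acts:
  assumes "mat_acts N e p A" "a \<in> reflective" "a \<in> quasi_periodic (2 * N) e" "i < N"
  shows "(\<Sum>m<N. A $$ (i, m) * a (int m)) = poly_act p a (int i)"
proof -
  have "(\<Sum>m<N. A $$ (i, m) * a (int m)) = (A *\<^sub>v seq_vec N a) $ i"
    using mat_acts_carrier[OF assms(1)] assms(4)
    by (auto simp: scalar_prod_def seq_vec_def atLeast0LessThan intro!: sum.cong)
  then show ?thesis
    using assms(4) by (simp add: mat_acts_apply[OF assms(1-3)]) (simp add: seq_vec_def)
qed

lemma mat_actsI:
  assumes "A \<in> carrier_mat N N"
    and "\<And>a i. a \<in> reflective \<Longrightarrow> a \<in> quasi_periodic (2 * N) e \<Longrightarrow> i < N \<Longrightarrow>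
      (\<Sum>m<N. A $$ (i, m) * a (int m)) = poly_act p a (int i)"
  shows "mat_acts N e p A"
  unfolding mat_acts_def
proof (intro conjI ballI)
  fix a assume "a \<in> reflective \<inter> quasi_periodic (2 * N) e"
  then show "A *\<^sub>v seq_vec N a = seq_vec N (poly_act p a)"
    using assms
    by (auto intro!: eq_vecI simp: scalar_prod_def seq_vec_def atLeast0LessThan)
qed (fact assms(1))

lemma mat_acts_mult:
  assumes "mat_acts N e p A" "mat_acts N e q B"
  shows "mat_acts N e (p * q) (A * B)"
  unfolding mat_acts_def
proof (intro conjI ballI)
  show "A * B \<in> carrier_mat N N"
    using assms by (auto simp: mat_acts_def)
  fix a assume a: "a \<in> reflective \<inter> quasi_periodic (2 * N) e"
  have "A * B *\<^sub>v seq_vec N a = A *\<^sub>v (B *\<^sub>v seq_vec N a)"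
    by (rule assoc_mult_mat_vec) (use assms in \<open>auto simp: mat_acts_def\<close>)
  then show "A * B *\<^sub>v seq_vec N a = seq_vec N (poly_act (p * q) a)"
    using a assms
    by (simp add: mat_acts_apply poly_act_mult poly_act_reflective poly_act_quasi_periodic)
qed

lemma mat_acts_pow:
  assumes "mat_acts N e p A"
  shows "mat_acts N e (p ^ n) (A ^\<^sub>m n)"
proof (induction n)
  case 0
  then show ?case
    using mat_acts_carrier[OF assms] by (simp add: mat_acts_def)
next
  case (Suc n)
  then show ?case
    using mat_acts_mult[OF Suc assms] by (simp add: mult.commute)
qed

lemma mat_acts_add_scalar:
  assumes "mat_acts N e p A"
  shows "mat_acts N e (p + [:c:]) (A + c \<cdot>\<^sub>m 1\<^sub>m N)"
proof (rule mat_actsI)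
  fix a :: "int \<Rightarrow> real" and i
  assume a: "a \<in> reflective" "a \<in> quasi_periodic (2 * N) e" and i: "i < N"
  have "(\<Sum>m<N. (A + c \<cdot>\<^sub>m 1\<^sub>m N) $$ (i, m) * a (int m)) =
      (\<Sum>m<N. A $$ (i, m) * a (int m)) + (\<Sum>m<N. if m = i then c * a (int m) else 0)"
    unfolding sum.distrib[symmetric]
    by (rule sum.cong) (use mat_acts_carrier[OF assms] i in \<open>auto simp: algebra_simps\<close>)
  then show "(\<Sum>m<N. (A + c \<cdot>\<^sub>m 1\<^sub>m N) $$ (i, m) * a (int m)) = poly_act (p + [:c:]) a (int i)"
    using i index_mat_acts[OF assms a i]
    by (simp add: poly_act_add poly_act_pCons shift_sum_def)
qed (use mat_acts_carrier[OF assms] in auto)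

lemma mat_acts_poly:
  assumes "mat_acts N e [:0, 1:] A"
  shows "mat_acts N e p (mat_poly p A)"
proof (rule mat_actsI)
  have A: "dim_row A = N" using mat_acts_carrier[OF assms] by simp
  then show "mat_poly p A \<in> carrier_mat N N" by (simp add: mat_poly_def)
  fix a :: "int \<Rightarrow> real" and i
  assume a: "a \<in> reflective" "a \<in> quasi_periodic (2 * N) e" and i: "i < N"
  have "(\<Sum>m<N. mat_poly p A $$ (i, m) * a (int m)) =
      (\<Sum>m<N. (\<Sum>n\<le>degree p. coeff p n * (A ^\<^sub>m n) $$ (i, m)) * a (int m))"
    by (rule sum.cong) (use A i in \<open>auto simp: mat_poly_def\<close>)
  also have "\<dots> = (\<Sum>n\<le>degree p. coeff p n * (\<Sum>m<N. (A ^\<^sub>m n) $$ (i, m) * a (int m)))"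
    unfolding sum_distrib_right sum_distrib_left
    by (subst sum.swap) (simp add: mult.assoc)
  also have "\<dots> = poly_act p a (int i)"
    by (simp only: index_mat_acts[OF mat_acts_pow[OF assms] a i] poly_act_X_power)
      (simp only: poly_act_def)
  finally show "(\<Sum>m<N. mat_poly p A $$ (i, m) * a (int m)) = poly_act p a (int i)" .
qed

text \<open>The transpose of \<open>Q_mat N\<close> unfolds the values on 0..N-1 to the window
  -N..N-1, \<open>sigma N e\<close> shifts by one with wrap-around factor \<open>e\<close>, and
  \<open>Q_mat N\<close> adds mirror entries. The result is a(i - 1) + a(-i - 2) = a(i - 1) + a(i +
  1).\<close>

lemma mat_acts_folded_sigma:
  assumes "e * e = 1"
  shows "mat_acts N e [:0, 1:] (Q_mat N * sigma N e * transpose_mat (Q_mat N))"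
  unfolding mat_acts_def
proof (intro conjI ballI)
  have Q: "Q_mat N \<in> carrier_mat N (2 * N)" "transpose_mat (Q_mat N) \<in> carrier_mat (2 * N) N"
    and s: "sigma N e \<in> carrier_mat (2 * N) (2 * N)"
    by (auto simp: Q_mat_def J_mat_def sigma_def)
  then show "Q_mat N * sigma N e * transpose_mat (Q_mat N) \<in> carrier_mat N N" by auto
  have Qij: "Q_mat N $$ (i, j) = (if i + j + 1 = N \<or> j = i + N then 1 else 0)"
    if "i < N" "j < 2 * N" for i j
    using that by (auto simp: Q_mat_def J_mat_def)
  fix a assume a: "a \<in> reflective \<inter> quasi_periodic (2 * N) e"
  define u where "u = vec (2 * N) (\<lambda>j. a (int j - int N))"
  define v where "v = vec (2 * N) (\<lambda>j. a (int j - int N - 1))"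
  have u: "transpose_mat (Q_mat N) *\<^sub>v seq_vec N a = u"
  proof (rule eq_vecI)
    fix j assume "j < dim_vec u"
    then have j: "j < 2 * N" by (simp add: u_def)
    \<comment> \<open>The row in which column \<open>j\<close> of \<open>Q_mat N\<close> has its
      entry 1.\<close>
    define j' where "j' = (if j < N then N - 1 - j else j - N)"
    have j': "j' < N" using j by (auto simp: j'_def)
    have "(transpose_mat (Q_mat N) *\<^sub>v seq_vec N a) $ j = (\<Sum>i<N. Q_mat N $$ (i, j) * a (int i))"
      using Q j by (auto simp: scalar_prod_def seq_vec_def atLeast0LessThan intro!: sum.cong)
    also have "\<dots> = (\<Sum>i<N. if i = j' then a (int i) else 0)"
      by (rule sum.cong) (use j in \<open>auto simp: Qij j'_def\<close>)
    also have "\<dots> = a (int j')" using j' by simp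
    also have "\<dots> = a (int j - int N)"
      using reflectiveD[of a "int j - int N"] a j by (auto simp: j'_def of_nat_diff algebra_simps)
    finally show "(transpose_mat (Q_mat N) *\<^sub>v seq_vec N a) $ j = u $ j"
      using j by (simp add: u_def)
  qed (use Q in \<open>auto simp: u_def\<close>)
  have v: "sigma N e *\<^sub>v u = v"
  proof (rule eq_vecI)
    fix i assume "i < dim_vec v"
    then have i: "i < 2 * N" by (simp add: v_def)
    define i' where "i' = (if i = 0 then 2 * N - 1 else i - 1)"
    have i': "i' < 2 * N" using i by (auto simp: i'_def)
    have "(sigma N e *\<^sub>v u) $ i = (\<Sum>j<2 * N. sigma N e $$ (i, j) * a (int j - int N))"
      using s i by (auto simp: scalar_prod_def u_def atLeast0LessThan intro!: sum.cong)
    also have "\<dots> = (\<Sum>j<2 * N. if j = i' then (if i = 0 then e else 1) * a (int j - int N) else 0)"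
      by (rule sum.cong) (use i in \<open>auto simp: sigma_def i'_def\<close>)
    also have "\<dots> = (if i = 0 then e else 1) * a (int i' - int N)" using i' by simp
    \<comment> \<open>At i = 0 the wrapped value is e * a(N - 1) = e * e * a(-N - 1).\<close>
    also have "\<dots> = a (int i - int N - 1)"
      using quasi_periodicD[of a "2 * N" e "- int N - 1"] a i assms
      by (auto simp: i'_def of_nat_diff mult.assoc[symmetric]) (simp_all add: algebra_simps)
    finally show "(sigma N e *\<^sub>v u) $ i = v $ i"
      using i by (simp add: v_def)
  qed (use s in \<open>auto simp: v_def\<close>)
  have w: "Q_mat N *\<^sub>v v = seq_vec N (poly_act [:0, 1:] a)"
  proof (rule eq_vecI)
    fix i assume "i < dim_vec (seq_vec N (poly_act [:0, 1:] a))"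
    then have i: "i < N" by (simp add: seq_vec_def)
    have "(Q_mat N *\<^sub>v v) $ i = (\<Sum>j<2 * N. Q_mat N $$ (i, j) * a (int j - int N - 1))"
      using Q i by (auto simp: scalar_prod_def v_def atLeast0LessThan intro!: sum.cong)
    also have "\<dots> = (\<Sum>j<2 * N. (if j = N - 1 - i then a (int j - int N - 1) else 0)
        + (if j = i + N then a (int j - int N - 1) else 0))"
      by (rule sum.cong) (use i in \<open>auto simp: Qij\<close>)
    also have "\<dots> = a (- int i - 2) + a (int i - 1)"
      using i by (simp add: sum.distrib of_nat_diff less_imp_diff_less algebra_simps)
    also have "\<dots> = poly_act [:0, 1:] a (int i)"
      using reflectiveD[of a "int i + 1"] a by (simp add: poly_act_X shift_sum_def algebra_simps)
    finally show "(Q_mat N *\<^sub>v v) $ i = seq_vec N (poly_act [:0, 1:] a) $ i"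
      using i by (simp add: seq_vec_def)
  qed (use Q in \<open>auto simp: seq_vec_def\<close>)
  have "Q_mat N * sigma N e * transpose_mat (Q_mat N) *\<^sub>v seq_vec N a
      = Q_mat N * sigma N e *\<^sub>v (transpose_mat (Q_mat N) *\<^sub>v seq_vec N a)"
    by (rule assoc_mult_mat_vec) (use Q s in auto)
  also have "\<dots> = Q_mat N *\<^sub>v (sigma N e *\<^sub>v u)"
    unfolding u by (rule assoc_mult_mat_vec) (use Q s in \<open>auto simp: u_def\<close>)
  finally show "Q_mat N * sigma N e * transpose_mat (Q_mat N) *\<^sub>v seq_vec N a
      = seq_vec N (poly_act [:0, 1:] a)"
    by (simp only: v w)
qed

text \<open>The symmetric extension of the unit at \<open>j\<close> with a(i + 2N) = e * a(i), for e
  = 1 or e = -1. The parity test stands for the power of \<open>e\<close> with the quotient as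
  exponent. The mirror image -1 - j has residue 2N - 1 - j and quotient -1, hence the extra factor
  \<open>e\<close>.\<close>

definition periodic_unit :: "nat \<Rightarrow> real \<Rightarrow> nat \<Rightarrow> int \<Rightarrow> real" where
  "periodic_unit N e j i = (if even (i div int (2 * N)) then 1 else e) *
     ((if i mod int (2 * N) = int j then 1 else 0)
      + e * (if i mod int (2 * N) = int (2 * N) - 1 - int j then 1 else 0))"

lemma periodic_unit_quasi_periodic:
  assumes "N \<ge> 1" "e * e = 1"
  shows "periodic_unit N e j \<in> quasi_periodic (2 * N) e"
proof -
  have "(i + int (2 * N)) div int (2 * N) = i div int (2 * N) + 1" for i
    using assms(1) by (simp add: div_add_self2)
  moreover have "(i + int (2 * N)) mod int (2 * N) = i mod int (2 * N)" for i
    by simp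
  ultimately show ?thesis
    unfolding quasi_periodic_def periodic_unit_def
    using assms(2) by (auto simp: mult.assoc[symmetric])
qed

lemma periodic_unit_reflective:
  assumes "N \<ge> 1" "e * e = 1"
  shows "periodic_unit N e j \<in> reflective"
  unfolding reflective_def
proof clarify
  fix i
  let ?M = "int (2 * N)"
  have M: "?M > 0" using assms(1) by simp
  define q t where "q = i div ?M" and "t = i mod ?M"
  have t: "0 \<le> t" "t < ?M" and i: "i = ?M * q + t"
    using M by (simp_all only: q_def t_def pos_mod_sign pos_mod_bound) simp
  \<comment> \<open>Reflection exchanges the residues j and 2N - 1 - j and flips the parity of the
    quotient; the two changes by a factor \<open>e\<close> cancel.\<close>
  have i': "- 1 - i = ?M * (- 1 - q) + (?M - 1 - t)"
    by (simp add: i algebra_simps)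
  have d: "(- 1 - i) div ?M = - 1 - q" "(- 1 - i) mod ?M = ?M - 1 - t"
    by (rule int_div_pos_eq[OF i'] int_mod_pos_eq[OF i']; use t in simp)+
  have ev: "even (- 1 - q) \<longleftrightarrow> odd q" by simp
  show "periodic_unit N e j (- 1 - i) = periodic_unit N e j i"
    unfolding periodic_unit_def d ev q_def[symmetric] t_def[symmetric]
    using assms(2) by (auto simp: algebra_simps)
qed

lemma periodic_unit_nonneg:
  assumes "0 \<le> i" "i < 2 * int N"
  shows "periodic_unit N e j i = (if i = int j then 1 else 0)
    + e * (if i = 2 * int N - 1 - int j then 1 else 0)"
proof -
  have "i div int (2 * N) = 0" "i mod int (2 * N) = i"
    using assms by simp_all
  then show ?thesis by (simp add: periodic_unit_def)
qed

text \<open>Averaging over the two signs cancels the images of \<open>\<delta>\<^sub>j\<close> at the far wall, so that only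
  the reflection at the origin survives within distance \<open>N\<close> of the index range.\<close>

lemma periodic_unit_average:
  assumes "j < N" "- 2 * int N \<le> i" "i < 2 * int N"
  shows "1 / 2 * periodic_unit N 1 j i + 1 / 2 * periodic_unit N (- 1) j i = refl_unit (int j) i"
proof (cases "i \<ge> 0")
  case True
  then show ?thesis
    using assms by (auto simp: periodic_unit_nonneg refl_unit_def unit_seq_def)
next
  case False
  have "i = int (2 * N) * (- 1) + (i + 2 * int N)" by simp
  then have "i div int (2 * N) = - 1" "i mod int (2 * N) = i + 2 * int N"
    by (rule int_div_pos_eq int_mod_pos_eq; use False assms in simp)+
  then show ?thesis
    using False assms by (auto simp: periodic_unit_def refl_unit_def unit_seq_def)
qed

text \<open>The far mirror 2N - 1 - j is at least N, so on 0..N-1 the extension is just the unit at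
  \<open>j\<close>.\<close>

lemma mat_acts_entry:
  assumes "mat_acts N e p A" "e * e = 1" "i < N" "j < N"
  shows "A $$ (i, j) = poly_act p (periodic_unit N e j) (int i)"
proof -
  have "poly_act p (periodic_unit N e j) (int i) = (\<Sum>m<N. A $$ (i, m) * periodic_unit N e j (int m))"
    by (rule index_mat_acts[symmetric, OF assms(1)])
      (use assms in \<open>auto intro!: periodic_unit_reflective periodic_unit_quasi_periodic\<close>)
  also have "\<dots> = (\<Sum>m<N. if m = j then A $$ (i, m) else 0)"
    by (rule sum.cong) (use assms(4) in \<open>auto simp: periodic_unit_nonneg\<close>)
  also have "\<dots> = A $$ (i, j)" using assms(4) by simp
  finally show ?thesis by simp
qed

lemma mat_acts_average:
  assumes A: "mat_acts N 1 p A" and B: "mat_acts N (- 1) p B" and deg: "degree p \<le> N"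
  shows "(1 / 2) \<cdot>\<^sub>m (A + B) = mat N N (\<lambda>(i, j). poly_act p (refl_unit (int j)) (int i))"
proof (rule eq_matI)
  fix i j
  assume "i < dim_row (mat N N (\<lambda>(i, j). poly_act p (refl_unit (int j)) (int i)))"
    and "j < dim_col (mat N N (\<lambda>(i, j). poly_act p (refl_unit (int j)) (int i)))"
  then have ij: "i < N" "j < N" by simp_all
  have "((1 / 2) \<cdot>\<^sub>m (A + B)) $$ (i, j) = 1 / 2 * (A $$ (i, j) + B $$ (i, j))"
    using ij mat_acts_carrier[OF A] mat_acts_carrier[OF B] by simp
  also have "\<dots> = poly_act p
      (\<lambda>i. 1 / 2 * periodic_unit N 1 j i + 1 / 2 * periodic_unit N (- 1) j i) (int i)"
    using ij by (simp only: poly_act_lincomb mat_acts_entry[OF A] mat_acts_entry[OF B])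
      (simp add: mat_acts_entry[OF A] mat_acts_entry[OF B])
  also have "\<dots> = poly_act p (refl_unit (int j)) (int i)"
    \<comment> \<open>From 0 <= i < N and a distance of at most N, the positions seen lie between -N
      and 2N - 1, where the average agrees with \<open>refl_unit\<close>.\<close>
    by (rule poly_act_cong[OF deg], rule periodic_unit_average) (use ij in auto)
  finally show "((1 / 2) \<cdot>\<^sub>m (A + B)) $$ (i, j) =
      mat N N (\<lambda>(i, j). poly_act p (refl_unit (int j)) (int i)) $$ (i, j)"
    using ij by simp
qed (use mat_acts_carrier[OF A] mat_acts_carrier[OF B] in auto)

section \<open>Entries of \<open>beta\<close> and the polynomials \<open>b_poly\<close>\<close>

lemma alpha_acts: "mat_acts N 1 [:0, 1:] (alpha N)"
  and beta_acts: "mat_acts N (- 1) [:0, 1:] (beta N)"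
  unfolding alpha_def beta_def by (rule mat_acts_folded_sigma; simp)+

lemma beta_carrier: "beta N \<in> carrier_mat N N"
  using beta_acts by (rule mat_acts_carrier)

text \<open>The entries are read off from S acting on the antiperiodic unit. The corner -1 arises at
  i = j = N - 1, where the right neighbour N is the far mirror image, of sign -1.\<close>

lemma beta_entry:
  assumes "i < N" "j < N"
  shows "beta N $$ (i, j) = gamma i j - (if i = N - 1 \<and> j = N - 1 then 1 else 0)"
proof -
  let ?u = "periodic_unit N (- 1) j"
  have u: "?u \<in> reflective" using assms by (intro periodic_unit_reflective) auto
  have b: "beta N $$ (i, j) = ?u (int i - 1) + ?u (int i + 1)"
    using assms by (simp add: mat_acts_entry[OF beta_acts] poly_act_X shift_sum_def)
  have 1: "?u (int i - 1) = (if i = 0 then ?u 0 else ?u (int (i - 1)))"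
    using reflectiveD[OF u, of 0] by (auto simp: of_nat_diff)
  show ?thesis
    unfolding b 1 using assms
    by (cases "i = 0") (auto simp: periodic_unit_nonneg gamma_def)
qed

lemma beta_mat:
  "beta N = mat N N (\<lambda>(i, j). gamma i j - (if i = N - 1 \<and> j = N - 1 then 1 else 0))"
  by (rule eq_matI) (use beta_carrier[of N] in \<open>auto simp: beta_entry\<close>)

text \<open>Only the last diagonal entry differs from \<open>gamma\<close>. In the three-term
  recurrence it turns X into X + 1, which adds one further copy of the preceding
  \<open>g_poly\<close>.\<close>

lemma b_poly_Suc: "b_poly (Suc k) = g_poly (Suc k) + g_poly k"
proof (cases k)
  case 0
  then show ?thesis
    by (simp add: b_poly_def beta_mat char_poly_mat det_single gamma_def g_poly_0 g_poly_1 one_pCons)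
next
  case (Suc n)
  let ?f = "\<lambda>i j. gamma i j - (if i = Suc n \<and> j = Suc n then 1 else 0)"
  let ?F = "\<lambda>i j. if i = j then [:- ?f i j, 1:] else [:- ?f i j:]"
  let ?G = "\<lambda>i j. if i = j then [:- gamma i j, 1:] else [:- gamma i j:]"
  have "b_poly (Suc (Suc n)) = det (mat (Suc (Suc n)) (Suc (Suc n)) (\<lambda>(i, j). ?F i j))"
    by (simp only: b_poly_def beta_mat char_poly_mat diff_Suc_1)
  also have "\<dots> = ?F (Suc n) (Suc n) * det (mat (Suc n) (Suc n) (\<lambda>(i, j). ?F i j))
    - ?F n (Suc n) * ?F (Suc n) n * det (mat n n (\<lambda>(i, j). ?F i j))"
    by (rule det_tridiagonal_corner) (auto simp: gamma_def)
  also have "mat (Suc n) (Suc n) (\<lambda>(i, j). ?F i j) = mat (Suc n) (Suc n) (\<lambda>(i, j). ?G i j)"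
    by (rule eq_matI) auto
  also have "mat n n (\<lambda>(i, j). ?F i j) = mat n n (\<lambda>(i, j). ?G i j)"
    by (rule eq_matI) auto
  also have "det (mat (Suc n) (Suc n) (\<lambda>(i, j). ?G i j)) = g_poly (Suc n)"
    by (simp only: g_poly_def leading_def char_poly_mat)
  also have "det (mat n n (\<lambda>(i, j). ?G i j)) = g_poly n"
    by (simp only: g_poly_def leading_def char_poly_mat)
  finally have "b_poly (Suc (Suc n)) = [:1, 1:] * g_poly (Suc n) - g_poly n"
    by (simp add: gamma_def)
  also have "\<dots> = g_poly (Suc (Suc n)) + g_poly (Suc n)"
    by (simp add: g_poly_Suc_Suc algebra_simps)
  finally show ?thesis
    by (simp add: Suc)
qed

lemma degree_h_poly: "degree (h_poly r) = r div 2"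
proof -
  have "degree (g_poly n) = n" for n
    unfolding g_poly_def using degree_monic_char_poly[of "leading n gamma" n] by (simp add: leading_def)
  moreover have "degree (b_poly n) = n" for n
    unfolding b_poly_def using degree_monic_char_poly[OF beta_carrier[of n]] by simp
  ultimately show ?thesis by (simp add: h_poly_def)
qed

section \<open>The Hankel determinant\<close>

text \<open>First h(S) moves the unit at 0 to position k, or for even r to the sum of the units at k
  and k - 1; then the power of S + 2, evaluated at 0, gives the binomials of
  \<open>moment_odd\<close> or \<open>moment_even\<close>.\<close>

lemma hankel_moment:
  assumes "r \<ge> 1"
  shows "poly_act (h_poly r * [:2, 1:] ^ ((r - 1) div 2 + n)) (refl_unit 0) 0
    = of_nat ((2 * n + r) choose n)"
proof -
  have *: "poly_act (h_poly r * [:2, 1:] ^ m) (refl_unit 0) 0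
    = poly_act ([:2, 1:] ^ m) (poly_act (h_poly r) (refl_unit 0)) 0" for m
    by (simp only: poly_act_mult mult.commute[of "h_poly r"])
  show ?thesis
  proof (cases "odd r")
    case True
    then obtain k where r: "r = 2 * k + 1" by (elim oddE)
    then have h: "h_poly r = g_poly k" "(r - 1) div 2 + n = k + n" by (simp_all add: h_poly_def)
    have "poly_act (h_poly r * [:2, 1:] ^ ((r - 1) div 2 + n)) (refl_unit 0) 0
      = of_nat ((2 * n + (2 * k + 1)) choose n)"
      unfolding * unfolding h poly_act_g_poly poly_act_power_refl_unit
      using moment_odd[of k n] by simp
    then show ?thesis by (simp only: r)
  next
    case False
    \<comment> \<open>With this choice (r - 1) div 2 is \<open>k\<close>, and
      \<open>h_poly r\<close> is \<open>b_poly (Suc k)\<close>.\<close>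
    then obtain k where r: "r = 2 * Suc k"
      using assms by (metis evenE mult_0_right not0_implies_Suc not_one_le_zero)
    then have h: "h_poly r = g_poly (Suc k) + g_poly k" "(r - 1) div 2 + n = k + n"
      by (simp_all add: h_poly_def b_poly_Suc)
    have "poly_act (h_poly r * [:2, 1:] ^ ((r - 1) div 2 + n)) (refl_unit 0) 0
      = of_nat ((2 * n + 2 * Suc k) choose n)"
      unfolding *
      unfolding h poly_act_add poly_act_g_poly poly_act_add_right poly_act_power_refl_unit
      using moment_even[of k n] by simp
    then show ?thesis by (simp only: r)
  qed
qed

lemma poly_act_power_refl_unit_0:
  "poly_act ([:2, 1:] ^ j) (refl_unit 0) (int m) = of_nat ((2 * j + 1) choose (j + m + 1))"
proof -
  have "nat (int m + int j) = j + m" "nat (int m + 1 + int j) = Suc (j + m)" by auto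
  then show ?thesis
    by (simp add: poly_act_power_refl_unit central_binomial_def)
qed

lemma det_hankel_reduction:
  "det (mat N N (\<lambda>(i, j). poly_act (F * [:2, 1:] ^ (i + j)) (refl_unit 0) 0)) =
   det (mat N N (\<lambda>(i, j). poly_act F (refl_unit (int j)) (int i)))"
proof -
  define u where "u j = poly_act ([:2, 1:] ^ j) (refl_unit 0)" for j
  let ?U = "mat N N (\<lambda>(m, j). u j (int m))"
  let ?F = "mat N N (\<lambda>(i, j). poly_act F (refl_unit (int j)) (int i))"
  let ?H = "mat N N (\<lambda>(i, j). poly_act (F * [:2, 1:] ^ (i + j)) (refl_unit 0) 0)"
  have u_refl: "u j \<in> reflective" for j
    unfolding u_def by (intro poly_act_reflective refl_unit_reflective)
  \<comment> \<open>The columns with j < N vanish from row N on, so truncating to size N loses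
    nothing.\<close>
  have u_out: "u j i = 0" if "j < N" "\<not> (- int N \<le> i \<and> i < int N)" for i j
  proof -
    have 0: "u j (int m) = 0" if "m \<ge> N" for m
      using that \<open>j < N\<close> by (simp add: u_def poly_act_power_refl_unit_0 binomial_eq_0)
    show ?thesis
    proof (cases "i \<ge> 0")
      case True
      then show ?thesis using 0[of "nat i"] that by simp
    next
      case False
      then show ?thesis using 0[of "nat (- 1 - i)"] that reflectiveD[OF u_refl, of j i] by simp
    qed
  qed
  have u_exp: "u j = (\<lambda>i. \<Sum>m<N. u j (int m) * refl_unit (int m) i)" if "j < N" for j
  proof
    fix i
    show "u j i = (\<Sum>m<N. u j (int m) * refl_unit (int m) i)"
    proof (cases "- int N \<le> i \<and> i < int N")
      case True
      then show ?thesis by (simp add: refl_unit_expansion[OF u_refl])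
    next
      case False
      then have "refl_unit (int m) i = 0" if "m < N" for m
        using that by (auto simp: refl_unit_def unit_seq_def)
      then show ?thesis using u_out[OF that False] by simp
    qed
  qed
  have FU: "(\<Sum>m<N. poly_act F (refl_unit (int m)) i * u j (int m)) = poly_act F (u j) i"
    if "j < N" for i j
  proof -
    have "poly_act F (u j) i = poly_act F (\<lambda>i. \<Sum>m<N. u j (int m) * refl_unit (int m) i) i"
      using u_exp[OF that] by (rule arg_cong)
    also have "\<dots> = (\<Sum>m<N. u j (int m) * poly_act F (refl_unit (int m)) i)"
      by (simp only: poly_act_sum_right)
    finally show ?thesis
      by (simp only: mult.commute)
  qed
  \<comment> \<open>Multiplying by row \<open>i\<close> of the transpose of U amounts to applying (S
    + 2)^i and evaluating at 0: (S + 2)^i is symmetric, and from 0 it sees only distances up to i <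
    N.\<close>
  have pairing: "(\<Sum>m<N. u i (int m) * v (int m)) = poly_act ([:2, 1:] ^ i) v 0"
    if "i < N" "v \<in> reflective" for i v
  proof -
    have "degree ([:2, 1:] ^ i :: real poly) \<le> i"
      using degree_power_le[of "[:2, 1:] :: real poly" i] by simp
    then have "poly_act ([:2, 1:] ^ i) v 0
        = poly_act ([:2, 1:] ^ i) (\<lambda>k. \<Sum>m<N. v (int m) * refl_unit (int m) k) 0"
      by (rule poly_act_cong, subst refl_unit_expansion) (use that in auto)
    also have "\<dots> = (\<Sum>m<N. v (int m) * poly_act ([:2, 1:] ^ i) (refl_unit (int m)) 0)"
      by (simp only: poly_act_sum_right)
    also have "\<dots> = (\<Sum>m<N. u i (int m) * v (int m))"
      by (simp only: u_def poly_act_refl_unit_swap[of _ _ 0] mult.commute)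
    finally show ?thesis by simp
  qed
  have "?H = transpose_mat ?U * (?F * ?U)"
  proof (rule eq_matI)
    fix i j assume "i < dim_row (transpose_mat ?U * (?F * ?U))" "j < dim_col (transpose_mat ?U * (?F * ?U))"
    then have ij: "i < N" "j < N" by simp_all
    have "(transpose_mat ?U * (?F * ?U)) $$ (i, j)
        = (\<Sum>m<N. u i (int m) * (\<Sum>n<N. poly_act F (refl_unit (int n)) (int m) * u j (int n)))"
      using ij by (simp add: scalar_prod_def atLeast0LessThan)
    also have "\<dots> = poly_act ([:2, 1:] ^ i) (poly_act F (u j)) 0"
      unfolding FU[OF ij(2)] by (rule pairing) (use ij u_refl poly_act_reflective in auto)
    also have "\<dots> = poly_act (F * [:2, 1:] ^ (i + j)) (refl_unit 0) 0"
      by (simp only: u_def poly_act_mult[symmetric] power_add mult.assoc mult.left_commute)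
    finally show "?H $$ (i, j) = (transpose_mat ?U * (?F * ?U)) $$ (i, j)"
      using ij by simp
  qed auto
  also have "det \<dots> = det (transpose_mat ?U) * det (?F * ?U)"
    by (rule det_mult[of _ N]) auto
  also have "det (?F * ?U) = det ?F * det ?U"
    by (rule det_mult[of _ N]) auto
  also have "det (transpose_mat ?U) = det ?U"
    by (rule det_transpose[of _ N]) simp
  also have "det ?U = 1"
  proof -
    \<comment> \<open>Entry (m, j) is binom(2j + 1, j + m + 1), which is 0 for m > j and 1 for m =
      j.\<close>
    have "upper_triangular ?U"
      unfolding upper_triangular_def by (auto simp: u_def poly_act_power_refl_unit_0 binomial_eq_0)
    then have "det ?U = prod_list (diag_mat ?U)"
      using mat_carrier by (rule det_upper_triangular)
    also have "\<dots> = 1"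
      by (rule prod_list_neutral) (auto simp: diag_mat_def u_def poly_act_power_refl_unit_0 mult_2[symmetric])
    finally show ?thesis .
  qed
  finally show ?thesis by simp
qed

theorem theorem6p1:
  fixes r k l N :: nat
  assumes "r \<ge> 1"
    and "k = r div 2"
    and "l = (r - 1) div 2"
    and "N \<ge> k + l"
    and "N \<ge> 1"
  shows "d_det r N = det (leading N (inf_mult (inf_poly (h_poly r) gamma)
                                       (inf_pow (inf_add gamma (inf_const 2)) l)))
       \<and> det (leading N (inf_mult (inf_poly (h_poly r) gamma)
                           (inf_pow (inf_add gamma (inf_const 2)) l)))
         = det ((1 / 2) \<cdot>\<^sub>m
             (mat_poly (h_poly r) (alpha N) * (alpha N + 2 \<cdot>\<^sub>m 1\<^sub>m N) ^\<^sub>m l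
              + mat_poly (h_poly r) (beta N) * (beta N + 2 \<cdot>\<^sub>m 1\<^sub>m N) ^\<^sub>m l))"
proof
  let ?F = "h_poly r * [:2, 1:] ^ l"
  let ?L = "leading N (inf_mult (inf_poly (h_poly r) gamma) (inf_pow (inf_add gamma (inf_const 2)) l))"
  let ?A = "mat_poly (h_poly r) (alpha N) * (alpha N + 2 \<cdot>\<^sub>m 1\<^sub>m N) ^\<^sub>m l"
  let ?B = "mat_poly (h_poly r) (beta N) * (beta N + 2 \<cdot>\<^sub>m 1\<^sub>m N) ^\<^sub>m l"
  have X2: "[:0, 1:] + [:2:] = ([:2, 1:] :: real poly)" by simp
  have "inf_acts ?F (inf_mult (inf_poly (h_poly r) gamma) (inf_pow (inf_add gamma (inf_const 2)) l))"
    using inf_acts_add[OF inf_acts_gamma inf_acts_const[of 2]] unfolding X2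
    by (intro inf_acts_mult inf_acts_pow inf_acts_poly inf_acts_gamma)
  then have L: "?L = mat N N (\<lambda>(i, j). poly_act ?F (refl_unit (int j)) (int i))"
    by (simp only: leading_def inf_acts_entry)
  have "mat N N (\<lambda>(i, j). of_nat ((2 * i + 2 * j + r) choose (i + j))) =
      mat N N (\<lambda>(i, j). poly_act (?F * [:2, 1:] ^ (i + j)) (refl_unit 0) 0)"
    \<comment> \<open>Merging the exponents to l + (i + j) gives the moment with n = i + j.\<close>
    unfolding assms(3) mult.assoc power_add[symmetric]
    by (intro cong_mat) (simp_all add: hankel_moment[OF assms(1)] distrib_left del: One_nat_def)
  then show "d_det r N = det ?L"
    unfolding d_det_def L det_hankel_reduction[symmetric] by (simp only:)
  have A: "mat_acts N 1 ?F ?A"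
    using mat_acts_add_scalar[OF alpha_acts, of N 2] unfolding X2
    by (intro mat_acts_mult mat_acts_pow mat_acts_poly alpha_acts)
  have B: "mat_acts N (- 1) ?F ?B"
    using mat_acts_add_scalar[OF beta_acts, of N 2] unfolding X2
    by (intro mat_acts_mult mat_acts_pow mat_acts_poly beta_acts)
  \<comment> \<open>The degree is at most k + l; this is where N >= k + l enters.\<close>
  have deg: "degree ?F \<le> N"
    using degree_mult_le[of "h_poly r" "[:2, 1:] ^ l"] degree_power_le[of "[:2, 1:] :: real poly" l]
      assms by (simp add: degree_h_poly)
  have "?L = (1 / 2) \<cdot>\<^sub>m (?A + ?B)"
    unfolding L by (rule mat_acts_average[OF A B deg, symmetric])
  then show "det ?L = det ((1 / 2) \<cdot>\<^sub>m (?A + ?B))" by simp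
qed

end
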